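(* Let $G$ be a connected $m$-uniform hypergraph on $n$ vertices, and let $B_G$ have a Smith normal form over $\mathbb{Z}_m$ with invariant divisors $d_1,\dots,d_r$. Then: (1) If $m$ is odd, the number of first Laplacian N-eigenvectors of $G$ is $m^{n-1-r}\prod_{i=1}^r d_i-1$, and the number of first signless Laplacian N-eigenvectors is $0$. (2) If $m$ is even, the number of first Laplacian N-eigenvectors of $G$ is $m^{n-1-r}\prod_{i=1}^r d_i-2^{n-1-\bar r}$, where $\bar r$ is the rank of $B_G$ over $\mathbb{Z}_2$; this is also the number of first signless Laplacian N-eigenvectors of $G$ if $0$ is an H-eigenvalue of $\mathcal{Q}(G)$. (3) If $m$ is even and $0$ is an N-eigenvalue of $\mathcal{Q}(G)$, the number of first signless Laplacian N-eigenvectors of $G$ is $m^{n-1-r}\prod_{i=1}^r d_i$. (All eigenvectors are counted up to nonzero scalar.)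
   Context: An $m$-uniform hypergraph $G$ has edges that are $m$-element subsets of its vertex set $[n]$. Its adjacency tensor $\mathcal{A}(G)$ has entry $\frac{1}{(m-1)!}$ at $(i_1,\dots,i_m)$ if $\{i_1,\dots,i_m\}$ is an edge and $0$ otherwise; $\mathcal{D}(G)$ is the diagonal tensor of vertex degrees; $\mathcal{L}(G)=\mathcal{D}(G)-\mathcal{A}(G)$, $\mathcal{Q}(G)=\mathcal{D}(G)+\mathcal{A}(G)$. For a tensor $\mathcal{T}$, $\lambda$ is an eigenvalue with eigenvector $x\in\mathbb{C}^n\setminus\{0\}$ if $\sum_{i_2,\dots,i_m}t_{ii_2\cdots i_m}x_{i_2}\cdots x_{i_m}=\lambda x_i^{m-1}$ for all $i$. An eigenvector is an H-eigenvector if it is a scalar multiple of a real vector, and an N-eigenvector otherwise; $\lambda$ is an H-eigenvalue if it has an H-eigenvector, and an N-eigenvalue if every eigenvector associated with it is an N-eigenvector. First Laplacian (resp. signless Laplacian) eigenvectors are eigenvectors of $\mathcal{L}(G)$ (resp. $\mathcal{Q}(G)$) for eigenvalue $0$, counted as points of $\mathbb{P}^{n-1}$. $B_G$ is the $|E(G)|\times n$ incidence matrix ($(e,v)$ entry $1$ iff $v\in e$, else $0$). A Smith normal form of $B$ over $\mathbb{Z}_m$ is $PBQ$ with $P,Q$ invertible over $\mathbb{Z}_m$, having diagonal entries $d_1,\dots,d_r$ in positions $(1,1),\dots,(r,r)$ and zeros elsewhere, where $1\le d_i\le m-1$, $d_i\mid d_{i+1}$, $d_i\mid m$. *)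

theory Defs
  imports
    Complex_Main
    "HOL-Library.Z2"
    "Berlekamp_Zassenhaus.Finite_Field"
    "Jordan_Normal_Form.Matrix"
    "Jordan_Normal_Form.DL_Rank"
begin

section \<open>Uniform hypergraphs on the vertex set \<open>{..<n}\<close>\<close>

definition uniform_hypergraph :: "nat \<Rightarrow> nat \<Rightarrow> nat set set \<Rightarrow> bool" where
  "uniform_hypergraph m n E \<longleftrightarrow> 0 < n \<and> (\<forall>e\<in>E. e \<subseteq> {..<n} \<and> card e = m)"

definition connected_hypergraph :: "nat \<Rightarrow> nat set set \<Rightarrow> bool" where
  "connected_hypergraph n E \<longleftrightarrow>
     (\<forall>u<n. \<forall>v<n. (u, v) \<in> {(a, b). \<exists>e\<in>E. a \<in> e \<and> b \<in> e}\<^sup>*)"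

definition degree_of :: "nat set set \<Rightarrow> nat \<Rightarrow> nat" where
  "degree_of E v = card {e \<in> E. v \<in> e}"

text \<open>The edges are listed in a fixed order \<open>es\<close>, which orders the rows of the matrix.\<close>

definition incidence_matrix :: "nat \<Rightarrow> nat set list \<Rightarrow> 'a :: zero_neq_one mat" where
  "incidence_matrix n es = mat (length es) n (\<lambda>(i, v). of_bool (v \<in> es ! i))"


section \<open>Tensors and their eigenvectors\<close>

text \<open>A tensor of order \<open>m\<close> and dimension \<open>n\<close> is represented by its entries; only the entries at
  index lists of length \<open>m\<close> over \<open>{..<n}\<close> matter.\<close>

type_synonym tensor = "nat list \<Rightarrow> complex"

definition adjacency_tensor :: "nat \<Rightarrow> nat set set \<Rightarrow> tensor" where
  "adjacency_tensor m E ix =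
     (if length ix = m \<and> set ix \<in> E then 1 / fact (m - 1) else 0)"

definition degree_tensor :: "nat \<Rightarrow> nat set set \<Rightarrow> tensor" where
  "degree_tensor m E ix =
     (if ix = replicate m (hd ix) then of_nat (degree_of E (hd ix)) else 0)"

definition laplacian_tensor :: "nat \<Rightarrow> nat set set \<Rightarrow> tensor" where
  "laplacian_tensor m E ix = degree_tensor m E ix - adjacency_tensor m E ix"

definition signless_laplacian_tensor :: "nat \<Rightarrow> nat set set \<Rightarrow> tensor" where
  "signless_laplacian_tensor m E ix = degree_tensor m E ix + adjacency_tensor m E ix"

definition tensor_apply :: "nat \<Rightarrow> nat \<Rightarrow> tensor \<Rightarrow> complex vec \<Rightarrow> nat \<Rightarrow> complex" where
  "tensor_apply m n T x i =
     (\<Sum>js | length js = m - 1 \<and> set js \<subseteq> {..<n}. T (i # js) * (\<Prod>j\<leftarrow>js. x $ j))"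

definition eigenvector_of :: "nat \<Rightarrow> nat \<Rightarrow> tensor \<Rightarrow> complex \<Rightarrow> complex vec \<Rightarrow> bool" where
  "eigenvector_of m n T l x \<longleftrightarrow>
     x \<in> carrier_vec n \<and> x \<noteq> 0\<^sub>v n \<and> (\<forall>i<n. tensor_apply m n T x i = l * (x $ i) ^ (m - 1))"

definition H_eigenvector :: "nat \<Rightarrow> nat \<Rightarrow> tensor \<Rightarrow> complex \<Rightarrow> complex vec \<Rightarrow> bool" where
  "H_eigenvector m n T l x \<longleftrightarrow>
     eigenvector_of m n T l x \<and>
     (\<exists>c. \<exists>y \<in> carrier_vec n. x = c \<cdot>\<^sub>v map_vec complex_of_real y)"

definition N_eigenvector :: "nat \<Rightarrow> nat \<Rightarrow> tensor \<Rightarrow> complex \<Rightarrow> complex vec \<Rightarrow> bool" where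
  "N_eigenvector m n T l x \<longleftrightarrow> eigenvector_of m n T l x \<and> \<not> H_eigenvector m n T l x"

definition H_eigenvalue :: "nat \<Rightarrow> nat \<Rightarrow> tensor \<Rightarrow> complex \<Rightarrow> bool" where
  "H_eigenvalue m n T l \<longleftrightarrow> (\<exists>x. H_eigenvector m n T l x)"

definition N_eigenvalue :: "nat \<Rightarrow> nat \<Rightarrow> tensor \<Rightarrow> complex \<Rightarrow> bool" where
  "N_eigenvalue m n T l \<longleftrightarrow>
     (\<exists>x. eigenvector_of m n T l x) \<and> (\<forall>x. eigenvector_of m n T l x \<longrightarrow> N_eigenvector m n T l x)"


section \<open>Counting points of projective space\<close>

text \<open>The classes of this relation on the nonzero vectors of \<open>carrier_vec n\<close> are the points of
  \<open>(n - 1)\<close>-dimensional projective space.\<close>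

definition proportional :: "(complex vec \<times> complex vec) set" where
  "proportional = {(x, y). \<exists>c. c \<noteq> 0 \<and> y = c \<cdot>\<^sub>v x}"

definition first_N_eigenvector_points :: "nat \<Rightarrow> nat \<Rightarrow> tensor \<Rightarrow> complex vec set set" where
  "first_N_eigenvector_points m n T = {x. N_eigenvector m n T 0 x} // proportional"

text \<open>Since \<open>card\<close> is \<open>0\<close> on infinite sets, finiteness is made explicit.\<close>

definition has_number :: "'a set \<Rightarrow> real \<Rightarrow> bool" where
  "has_number A k \<longleftrightarrow> finite A \<and> real (card A) = k"


section \<open>Smith normal form over \<open>\<int>\<^sub>m\<close>\<close>

text \<open>Here \<open>m = CARD('m)\<close>, and \<open>'m mod_ring\<close> is the ring of integers modulo \<open>m\<close>. The
  invariant divisors \<open>ds\<close> are natural numbers, reduced modulo \<open>m\<close> only as matrix entries.\<close>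

definition has_smith_normal_form :: "'m :: nontriv mod_ring mat \<Rightarrow> nat list \<Rightarrow> bool" where
  "has_smith_normal_form B ds \<longleftrightarrow>
     length ds \<le> min (dim_row B) (dim_col B) \<and>
     (\<forall>d \<in> set ds. 1 \<le> d \<and> d \<le> CARD('m) - 1 \<and> d dvd CARD('m)) \<and>
     (\<forall>i. Suc i < length ds \<longrightarrow> ds ! i dvd ds ! Suc i) \<and>
     (\<exists>P Q. P \<in> carrier_mat (dim_row B) (dim_row B) \<and> invertible_mat P \<and>
            Q \<in> carrier_mat (dim_col B) (dim_col B) \<and> invertible_mat Q \<and>
            P * B * Q = mat (dim_row B) (dim_col B)
              (\<lambda>(i, j). if i = j \<and> i < length ds then of_nat (ds ! i) else 0))"

end

(* At a coordinate of maximal modulus the eigenvalue equation for 0 is an equality case of the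
   triangle inequality. By connectedness, a first (signless) Laplacian eigenvector with first
   coordinate 1 therefore consists of m-th roots of unity, and its product over every edge is 1
   (resp. -1). Taking exponents, the normalized Laplacian eigenvectors form the kernel of the
   incidence matrix over Z_m modulo the constant vectors, which the Smith normal form counts;
   those of the signless Laplacian form a coset of that group or are absent. The H-eigenvectors
   are the normalized vectors with entries 1 and -1, that is, the same kernel over Z_2. *)

theory Submission
  imports Defs "Jordan_Normal_Form.Matrix_Kernel" "HOL-Combinatorics.Multiset_Permutations"
begin

section \<open>Counting kernels of matrices\<close>

text \<open>Since Z_m is in general not a field, kernels are counted as finite sets: a diagonal
  entry d dividing m is killed by exactly d residues, and a zero column is free and contributes m.
  Over Z_2 the same kind of count becomes a power of 2 determined by the rank. The passage between
  residues and roots of unity is made once, for a finite commutative ring in which m = 0 and an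
  injective additive character into the complex numbers; Z_m and Z_2 are its two instances. One
  factor m (or 2) of the kernel is spent on normalizing the first coordinate, hence the exponents n
  - 1 - r and n - 1 - rbar. Integer exponents make this division valid without first bounding r by n
  - 1. Both tensors have the form degree tensor minus s times adjacency tensor with s * s = 1, so s
  = 1 and s = -1 share the analysis of eigenvectors. One solution w for s = -1 transports the count
  of all solutions from s = 1, but the count of real solutions only if w is real; this is where
  H-eigenvalues and N-eigenvalues part.\<close>

lemma card_vec_PiE:
  "card {v \<in> carrier_vec n. \<forall>i<n. v $ i \<in> S i} = (\<Prod>i<n. card (S i))"
proof -
  have "bij_betw (vec n) (PiE {..<n} S) {v \<in> carrier_vec n. \<forall>i<n. v $ i \<in> S i}"
    by (rule bij_betwI[where g = "\<lambda>v. restrict (($) v) {..<n}"])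
       (auto simp: PiE_iff extensional_def fun_eq_iff)
  then show ?thesis
    by (simp add: bij_betw_same_card[symmetric] card_PiE)
qed

lemma card_carrier_vec: "card (carrier_vec n :: 'a vec set) = CARD('a) ^ n"
  using card_vec_PiE[of n "\<lambda>_. UNIV :: 'a set"] by simp

lemma finite_carrier_vec: "finite (carrier_vec n :: 'a :: finite vec set)"
  by (rule card_ge_0_finite) (simp add: card_carrier_vec)

text \<open>The fibers of \<open>A\<close> over its image are translates of the kernel, so counting
  the domain by fibers gives the product. This is rank-nullity without dimensions, valid over any
  finite commutative ring.\<close>

lemma card_mat_kernel_times_card_image:
  fixes A :: "'a :: {comm_ring_1, finite} mat"
  assumes A: "A \<in> carrier_mat nr nc"
  shows "card (mat_kernel A) * card ((*\<^sub>v) A ` carrier_vec nc) = CARD('a) ^ nc"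
proof -
  have fiber: "card {x \<in> carrier_vec nc. A *\<^sub>v x = y} = card (mat_kernel A)"
    if y: "y \<in> (*\<^sub>v) A ` carrier_vec nc" for y
  proof -
    obtain z where z: "z \<in> carrier_vec nc" "y = A *\<^sub>v z"
      using y by blast
    have "bij_betw (\<lambda>x. x + z) (mat_kernel A) {x \<in> carrier_vec nc. A *\<^sub>v x = y}"
    proof (rule bij_betwI[where g = "\<lambda>x. x - z"])
      show "(\<lambda>x. x + z) \<in> mat_kernel A \<rightarrow> {x \<in> carrier_vec nc. A *\<^sub>v x = y}"
        using A z by (auto simp: mat_kernel[OF A] mult_add_distrib_mat_vec[OF A])
      show "(\<lambda>x. x - z) \<in> {x \<in> carrier_vec nc. A *\<^sub>v x = y} \<rightarrow> mat_kernel A"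
        using A z by (auto simp: mat_kernel[OF A] mult_minus_distrib_mat_vec[OF A])
    qed (use z in \<open>auto simp: mat_kernel[OF A]\<close>)
    then show ?thesis
      by (simp add: bij_betw_same_card)
  qed
  have "CARD('a) ^ nc = (\<Sum>x\<in>(carrier_vec nc :: 'a vec set). 1)"
    by (simp add: card_carrier_vec)
  also have "\<dots> = (\<Sum>y\<in>(*\<^sub>v) A ` carrier_vec nc. \<Sum>x\<in>{x \<in> carrier_vec nc. A *\<^sub>v x = y}. 1)"
    by (rule sum.image_gen) (rule finite_carrier_vec)
  also have "\<dots> = card (mat_kernel A) * card ((*\<^sub>v) A ` carrier_vec nc)"
    by (simp add: fiber)
  finally show ?thesis ..
qed

lemma (in vec_space) col_space_image:
  assumes A: "A \<in> carrier_mat n nc"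
  shows "span (set (cols A)) = (*\<^sub>v) A ` carrier_vec nc"
  using col_space_eq[OF A] A unfolding col_space_def by auto

text \<open>A vector of \<open>S\<close> outside \<open>span U\<close> could be added to
  \<open>U\<close> without losing independence, against maximality. This links the rank, known as
  the size of a maximal independent set of columns, to the column space.\<close>

lemma (in vec_space) span_maximal_lin_indpt:
  assumes S: "S \<subseteq> carrier_vec n" and U: "maximal U (\<lambda>T. T \<subseteq> S \<and> lin_indpt T)"
  shows "span U = span S"
proof
  have US: "U \<subseteq> S" and indpt: "lin_indpt U"
    using U by (auto simp: maximal_def)
  show "span U \<subseteq> span S"
    using US by (rule span_is_monotone)
  have "s \<in> span U" if "s \<in> S" for s
  proof (rule ccontr)
    assume s: "s \<notin> span U"
    have Uc: "U \<subseteq> carrier_vec n" "s \<in> carrier_vec n"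
      using US S that by auto
    then have "s \<notin> U"
      using s span_mem by auto
    have "lin_indpt (insert s U)"
      using lin_dep_iff_in_span[of U s] indpt Uc s \<open>s \<notin> U\<close> by auto
    then show False
      using U that US \<open>s \<notin> U\<close> unfolding maximal_def by blast
  qed
  then show "span S \<subseteq> span U"
    using US S by (intro span_is_subset span_is_submodule) auto
qed

text \<open>A maximal independent set of columns forms a matrix \<open>M\<close> with the same image
  as \<open>A\<close> and trivial kernel, so the image has as many elements as the domain of
  \<open>M\<close>.\<close>

lemma card_image_rank:
  fixes A :: "'a :: {field, finite} mat"
  assumes A: "A \<in> carrier_mat nr nc"
  shows "card ((*\<^sub>v) A ` carrier_vec nc) = CARD('a) ^ vec_space.rank nr A"
proof -
  interpret vec_space "TYPE('a)" nr .
  have "lin_indpt {}"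
    by (simp add: lin_dep_def)
  then obtain U where fin: "finite U" and U: "maximal U (\<lambda>T. T \<subseteq> set (cols A) \<and> lin_indpt T)"
    using maximal_exists_superset[of "set (cols A)" "\<lambda>T. T \<subseteq> set (cols A) \<and> lin_indpt T" "{}"]
    by auto
  have US: "U \<subseteq> set (cols A)" and indpt: "lin_indpt U"
    using U by (auto simp: maximal_def)
  have colsA: "set (cols A) \<subseteq> carrier_vec nr"
    using A cols_dim by blast
  obtain us where us: "set us = U" "distinct us"
    using finite_distinct_list[OF fin] by auto
  define M where "M = mat_of_cols nr us"
  have M: "M \<in> carrier_mat nr (length us)"
    by (simp add: M_def)
  have cols: "cols M = us"
    using us US colsA unfolding M_def by (intro cols_mat_of_cols) auto
  have "mat_kernel M = {0\<^sub>v (length us)}"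
    using lin_depI[OF M] indpt us M by (auto simp: mat_kernel[OF M] cols)
  moreover have "(*\<^sub>v) M ` carrier_vec (length us) = (*\<^sub>v) A ` carrier_vec nc"
    using span_maximal_lin_indpt[OF colsA U] col_space_image[OF M] col_space_image[OF A]
    by (simp add: cols us)
  ultimately have "card ((*\<^sub>v) A ` carrier_vec nc) = CARD('a) ^ length us"
    using card_mat_kernel_times_card_image[OF M] by simp
  then show ?thesis
    using rank_card_indpt[OF A U] us distinct_card by metis
qed

lemma card_mat_kernel_rank:
  fixes A :: "'a :: {field, finite} mat"
  assumes A: "A \<in> carrier_mat nr nc"
  shows "real (card (mat_kernel A)) = real CARD('a) powi (int nc - int (vec_space.rank nr A))"
proof -
  have "real (card (mat_kernel A)) * real CARD('a) ^ vec_space.rank nr A = real CARD('a) ^ nc"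
    using card_mat_kernel_times_card_image[OF A] card_image_rank[OF A]
    by (metis of_nat_mult of_nat_power)
  then show ?thesis
    by (simp add: power_int_diff divide_simps)
qed

section \<open>Kernels over Z_m and the Smith normal form\<close>

lemma of_nat_mod_ring_eq_0_iff:
  "of_nat k = (0 :: 'm :: nontriv mod_ring) \<longleftrightarrow> CARD('m) dvd k"
proof -
  have "of_nat k = (0 :: 'm mod_ring) \<longleftrightarrow> int k mod int CARD('m) = 0"
    unfolding of_nat_of_int_mod_ring by transfer simp
  then show ?thesis
    by (simp add: dvd_eq_mod_eq_0 flip: zmod_int)
qed

lemma mod_ring_of_nat:
  obtains k where "k < CARD('m)" "x = (of_nat k :: 'm :: nontriv mod_ring)"
proof
  have "0 \<le> to_int_mod_ring x" "to_int_mod_ring x < int CARD('m)"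
    using range_to_int_mod_ring[where ?'a = 'm] by auto
  then show "nat (to_int_mod_ring x) < CARD('m)"
    by linarith
  show "x = of_nat (nat (to_int_mod_ring x))"
    using \<open>0 \<le> to_int_mod_ring x\<close> unfolding of_nat_of_int_mod_ring by simp
qed

text \<open>With \<open>CARD('m) = d * q\<close>, the residues killed by \<open>d\<close> are the
  classes of \<open>q * k\<close>, and these are distinct for \<open>k < d\<close>.\<close>

lemma card_annihilator_mod_ring:
  assumes "d dvd CARD('m :: nontriv)"
  shows "card {b :: 'm mod_ring. of_nat d * b = 0} = d"
proof -
  obtain q where q: "CARD('m) = d * q"
    using assms by auto
  have pos: "d > 0" "q > 0"
    using q zero_less_card_finite[where ?'a = 'm] by (auto intro: Nat.gr0I)
  have "inj_on (\<lambda>k. of_nat (q * k) :: 'm mod_ring) {..<d}"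
  proof (rule linorder_inj_onI')
    fix i j assume ij: "i \<in> {..<d}" "j \<in> {..<d}" "i < j"
    have "of_nat (q * j) = (of_nat (q * i) + of_nat (q * (j - i)) :: 'm mod_ring)"
      using ij by (simp flip: of_nat_add add: algebra_simps)
    moreover have "\<not> d * q dvd q * (j - i)"
      using ij pos nat_dvd_not_less[of "j - i" d] by (auto simp: mult.commute)
    ultimately show "(of_nat (q * i) :: 'm mod_ring) \<noteq> of_nat (q * j)"
      using of_nat_mod_ring_eq_0_iff[of "q * (j - i)", where ?'m = 'm] q by auto
  qed
  moreover have "(\<lambda>k. of_nat (q * k)) ` {..<d} = {b :: 'm mod_ring. of_nat d * b = 0}"
  proof safe
    fix k
    have "of_nat d * of_nat (q * k) = (of_nat (d * q * k) :: 'm mod_ring)"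
      by simp
    then show "of_nat d * of_nat (q * k) = (0 :: 'm mod_ring)"
      by (simp only: of_nat_mod_ring_eq_0_iff q dvd_triv_left)
  next
    fix b :: "'m mod_ring" assume b: "of_nat d * b = 0"
    obtain k where k: "k < CARD('m)" "b = of_nat k"
      by (rule mod_ring_of_nat)
    have "d * q dvd d * k"
      using b unfolding k q[symmetric] of_nat_mult[symmetric] of_nat_mod_ring_eq_0_iff .
    then obtain l where "k = q * l"
      using pos by auto
    then show "b \<in> (\<lambda>k. of_nat (q * k)) ` {..<d}"
      using k q pos by auto
  qed
  ultimately show ?thesis
    by (metis card_image card_lessThan)
qed

text \<open>Multiplication by \<open>Q\<close> carries the kernel of \<open>P * B * Q\<close>
  bijectively to that of \<open>B\<close>, because applying the injective \<open>P\<close> does not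
  change which vectors vanish.\<close>

lemma card_mat_kernel_equivalent:
  fixes B :: "'a :: comm_ring_1 mat"
  assumes B: "B \<in> carrier_mat nr nc"
    and P: "P \<in> carrier_mat nr nr" "invertible_mat P"
    and Q: "Q \<in> carrier_mat nc nc" "invertible_mat Q"
  shows "card (mat_kernel (P * B * Q)) = card (mat_kernel B)"
proof -
  obtain P' where P': "P' * P = 1\<^sub>m nr" "P' \<in> carrier_mat nr nr"
    using P unfolding invertible_mat_def inverts_mat_def
    by (metis carrier_matD carrier_matI index_mult_mat(2,3) index_one_mat(2,3))
  obtain Q' where Q': "Q * Q' = 1\<^sub>m nc" "Q' * Q = 1\<^sub>m nc" "Q' \<in> carrier_mat nc nc"
    using Q unfolding invertible_mat_def inverts_mat_def
    by (metis carrier_matD carrier_matI index_mult_mat(2,3) index_one_mat(2,3))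
  define D where "D = P * B * Q"
  have D: "D \<in> carrier_mat nr nc"
    using B P Q by (auto simp: D_def)
  have PBQ: "D *\<^sub>v v = P *\<^sub>v (B *\<^sub>v (Q *\<^sub>v v))" if "v \<in> carrier_vec nc" for v
    using that B P(1) Q(1)
    by (simp add: D_def assoc_mult_mat_vec[of "P * B" nr nc Q nc] assoc_mult_mat_vec[of P nr nr B nc]
        del: assoc_mult_mat)
  have P_eq_0: "P *\<^sub>v w = 0\<^sub>v nr \<longleftrightarrow> w = 0\<^sub>v nr" if w: "w \<in> carrier_vec nr" for w
  proof
    assume "P *\<^sub>v w = 0\<^sub>v nr"
    then have "(P' * P) *\<^sub>v w = 0\<^sub>v nr"
      unfolding assoc_mult_mat_vec[OF P'(2) P(1) w] using P'(2) by (intro eq_vecI) auto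
    then show "w = 0\<^sub>v nr"
      using w P'(1) one_mult_mat_vec by metis
  qed (use P in auto)
  have inv: "Q' *\<^sub>v (Q *\<^sub>v v) = v" "Q *\<^sub>v (Q' *\<^sub>v v) = v" if v: "v \<in> carrier_vec nc" for v
    using assoc_mult_mat_vec[OF Q'(3) Q(1) v] assoc_mult_mat_vec[OF Q(1) Q'(3) v] v Q' by auto
  have "bij_betw ((*\<^sub>v) Q) (mat_kernel (D)) (mat_kernel B)"
  proof (rule bij_betwI[where g = "(*\<^sub>v) Q'"])
    show "(*\<^sub>v) Q \<in> mat_kernel (D) \<rightarrow> mat_kernel B"
      using B Q P_eq_0 by (auto simp: mat_kernel[OF D] mat_kernel[OF B] PBQ)
    show "(*\<^sub>v) Q' \<in> mat_kernel B \<rightarrow> mat_kernel (D)"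
      using B P Q Q' P_eq_0 by (auto simp: mat_kernel[OF D] mat_kernel[OF B] PBQ inv)
  qed (auto simp: inv mat_kernel[OF D] mat_kernel[OF B])
  then show ?thesis
    unfolding D_def by (rule bij_betw_same_card)
qed

text \<open>The kernel of the diagonal form is a product of coordinate sets: the annihilator of
  \<open>ds ! i\<close>, with \<open>ds ! i\<close> elements, for \<open>i < r\<close>, and the
  whole ring for the other coordinates.\<close>

lemma card_mat_kernel_smith:
  fixes B :: "'m :: nontriv mod_ring mat"
  assumes B: "B \<in> carrier_mat nr nc" and snf: "has_smith_normal_form B ds"
  shows "real (card (mat_kernel B)) =
    real CARD('m) powi (int nc - int (length ds)) * (\<Prod>i<length ds. real (ds ! i))"
proof -
  define r where "r = length ds"
  define D :: "'m mod_ring mat"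
    where "D = mat nr nc (\<lambda>(i, j). if i = j \<and> i < r then of_nat (ds ! i) else 0)"
  have D: "D \<in> carrier_mat nr nc"
    by (simp add: D_def)
  have r: "r \<le> nr" "r \<le> nc" and dvd: "\<And>i. i < r \<Longrightarrow> ds ! i dvd CARD('m)"
    using snf B by (auto simp: has_smith_normal_form_def r_def)
  obtain P Q where PQ: "P \<in> carrier_mat nr nr" "invertible_mat P"
    "Q \<in> carrier_mat nc nc" "invertible_mat Q" and "P * B * Q = D"
    using snf B by (auto simp: has_smith_normal_form_def r_def D_def)
  define S :: "nat \<Rightarrow> 'm mod_ring set"
    where "S i = (if i < r then {b. of_nat (ds ! i) * b = 0} else UNIV)" for i
  have D_app: "(D *\<^sub>v v) $ i = (if i < r then of_nat (ds ! i) * v $ i else 0)"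
    if "v \<in> carrier_vec nc" "i < nr" for v i
  proof -
    have "(D *\<^sub>v v) $ i = (\<Sum>j<nc. (if i = j \<and> i < r then of_nat (ds ! i) else 0) * v $ j)"
      using that D unfolding D_def by (simp add: scalar_prod_def lessThan_atLeast0)
    also have "\<dots> = (\<Sum>j<nc. if j = i then (if i < r then of_nat (ds ! i) * v $ i else 0) else 0)"
      by (intro sum.cong) auto
    also have "\<dots> = (if i < r then of_nat (ds ! i) * v $ i else 0)"
      using r by simp
    finally show ?thesis .
  qed
  have "D *\<^sub>v v = 0\<^sub>v nr \<longleftrightarrow> (\<forall>i<nc. v $ i \<in> S i)" if v: "v \<in> carrier_vec nc" for v
  proof -
    have "D *\<^sub>v v = 0\<^sub>v nr \<longleftrightarrow> (\<forall>i<nr. (D *\<^sub>v v) $ i = 0)"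
      using D by (auto simp: vec_eq_iff)
    \<comment> \<open>As \<open>r\<close> is at most \<open>nr\<close> and \<open>nc\<close>, every
      invariant divisor has its row and its column; rows past \<open>r\<close> impose nothing, in
      accordance with \<open>S i = UNIV\<close>.\<close>
    also have "\<dots> \<longleftrightarrow> (\<forall>i<nc. v $ i \<in> S i)"
      using r by (auto simp: D_app[OF v] S_def)
    finally show ?thesis .
  qed
  then have "mat_kernel D = {v \<in> carrier_vec nc. \<forall>i<nc. v $ i \<in> S i}"
    by (auto simp: mat_kernel[OF D])
  then have "card (mat_kernel B) = (\<Prod>i<nc. card (S i))"
    using card_mat_kernel_equivalent[OF B PQ] \<open>P * B * Q = D\<close> by (simp add: card_vec_PiE)
  also have "\<dots> = (\<Prod>i\<in>{..<r} \<union> {r..<nc}. card (S i))"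
    using r by (intro prod.cong) auto
  also have "\<dots> = (\<Prod>i<r. ds ! i) * CARD('m) ^ (nc - r)"
    using dvd by (subst prod.union_disjoint) (auto simp: S_def card_annihilator_mod_ring)
  finally have "card (mat_kernel B) = (\<Prod>i<r. ds ! i) * CARD('m) ^ (nc - r)" .
  moreover have "int nc - int r = int (nc - r)"
    using r by simp
  ultimately show ?thesis
    unfolding r_def[symmetric] by (metis mult.commute of_nat_mult of_nat_power of_nat_prod power_int_of_nat)
qed

section \<open>Kernels of incidence matrices and roots of unity\<close>

lemma incidence_matrix_carrier: "incidence_matrix n es \<in> carrier_mat (length es) n"
  by (simp add: incidence_matrix_def)

lemma incidence_matrix_mult_vec:
  fixes a :: "'a :: comm_ring_1 vec"
  assumes "a \<in> carrier_vec n" "i < length es" "es ! i \<subseteq> {..<n}"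
  shows "(incidence_matrix n es *\<^sub>v a) $ i = (\<Sum>j\<in>es ! i. a $ j)"
proof -
  have "(incidence_matrix n es *\<^sub>v a) $ i = (\<Sum>j<n. of_bool (j \<in> es ! i) * a $ j)"
    using assms by (simp add: incidence_matrix_def scalar_prod_def lessThan_atLeast0)
  also have "\<dots> = (\<Sum>j\<in>{..<n} \<inter> es ! i. a $ j)"
    by (simp add: sum.inter_restrict of_bool_def if_distrib[of "\<lambda>x. x * _"] cong: if_cong)
  also have "{..<n} \<inter> es ! i = es ! i"
    using assms by auto
  finally show ?thesis .
qed

lemma mat_kernel_incidence_matrix:
  assumes "uniform_hypergraph m n (set es)"
  shows "mat_kernel (incidence_matrix n es) =
    {a :: 'a :: comm_ring_1 vec. a \<in> carrier_vec n \<and> (\<forall>e\<in>set es. (\<Sum>j\<in>e. a $ j) = 0)}"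
proof -
  have sub: "es ! i \<subseteq> {..<n}" if "i < length es" for i
    using assms that by (auto simp: uniform_hypergraph_def)
  have "incidence_matrix n es *\<^sub>v a = 0\<^sub>v (length es) \<longleftrightarrow> (\<forall>e\<in>set es. (\<Sum>j\<in>e. a $ j) = 0)"
    if a: "a \<in> carrier_vec n" for a :: "'a vec"
  proof -
    have "incidence_matrix n es *\<^sub>v a = 0\<^sub>v (length es) \<longleftrightarrow>
        (\<forall>i<length es. (incidence_matrix n es *\<^sub>v a) $ i = 0)"
      by (auto simp: vec_eq_iff incidence_matrix_def)
    also have "\<dots> \<longleftrightarrow> (\<forall>i<length es. (\<Sum>j\<in>es ! i. a $ j) = 0)"
      using a sub by (simp add: incidence_matrix_mult_vec)
    finally show ?thesis
      by (simp add: all_set_conv_all_nth)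
  qed
  then show ?thesis
    by (auto simp: mat_kernel[OF incidence_matrix_carrier])
qed

lemma character_sum:
  fixes \<chi> :: "'a :: ab_group_add \<Rightarrow> 'b :: comm_monoid_mult"
  assumes "\<And>a b. \<chi> (a + b) = \<chi> a * \<chi> b" "\<chi> 0 = 1"
  shows "\<chi> (sum f A) = (\<Prod>x\<in>A. \<chi> (f x))"
  by (induction A rule: infinite_finite_induct) (simp_all add: assms)

text \<open>The all-ones vector lies in the kernel because edges have \<open>m = 0\<close> elements; translating
  by its multiples normalizes the first coordinate, which accounts for the factor \<open>CARD('a)\<close>.\<close>

lemma card_kernel_eq_card_character_vectors:
  fixes \<chi> :: "'a :: {comm_ring_1, finite} \<Rightarrow> complex"
  assumes H: "uniform_hypergraph m n (set es)" and m: "of_nat m = (0 :: 'a)"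
    and \<chi>: "\<And>a b. \<chi> (a + b) = \<chi> a * \<chi> b" "\<chi> 0 = 1" "inj \<chi>"
  shows "card (mat_kernel (incidence_matrix n es :: 'a mat)) = CARD('a) *
    card {y \<in> carrier_vec n. y $ 0 = 1 \<and> (\<forall>i<n. y $ i \<in> range \<chi>) \<and>
      (\<forall>e\<in>set es. (\<Prod>j\<in>e. y $ j) = 1)}"
    (is "card ?K = _ * card ?Y")
proof -
  have n: "n > 0" and e: "\<And>e. e \<in> set es \<Longrightarrow> e \<subseteq> {..<n} \<and> card e = m"
    using H by (auto simp: uniform_hypergraph_def)
  have "bij_betw (\<lambda>(c, a). a + vec n (\<lambda>_. c)) (UNIV \<times> {a \<in> ?K. a $ 0 = 0}) ?K"
  proof (rule bij_betwI[where g = "\<lambda>a. (a $ 0, a - vec n (\<lambda>_. a $ 0))"])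
    have shift: "(\<Sum>j\<in>e. (a + vec n (\<lambda>_. c)) $ j) = (\<Sum>j\<in>e. a $ j)"
      "(\<Sum>j\<in>e. (a - vec n (\<lambda>_. c)) $ j) = (\<Sum>j\<in>e. a $ j)"
      if "e \<in> set es" "a \<in> carrier_vec n" for e a and c :: 'a
    proof -
      have "(\<Sum>j\<in>e. (a + vec n (\<lambda>_. c)) $ j) = (\<Sum>j\<in>e. a $ j + c)"
        using that e[of e] by (intro sum.cong) auto
      then show "(\<Sum>j\<in>e. (a + vec n (\<lambda>_. c)) $ j) = (\<Sum>j\<in>e. a $ j)"
        using that e[of e] m by (simp add: sum.distrib)
      have "(\<Sum>j\<in>e. (a - vec n (\<lambda>_. c)) $ j) = (\<Sum>j\<in>e. a $ j - c)"
        using that e[of e] by (intro sum.cong) auto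
      then show "(\<Sum>j\<in>e. (a - vec n (\<lambda>_. c)) $ j) = (\<Sum>j\<in>e. a $ j)"
        using that e[of e] m by (simp add: sum_subtractf)
    qed
    show "(\<lambda>(c, a). a + vec n (\<lambda>_. c)) \<in> UNIV \<times> {a \<in> ?K. a $ 0 = 0} \<rightarrow> ?K"
      by (auto simp: mat_kernel_incidence_matrix[OF H] shift)
    show "(\<lambda>a. (a $ 0, a - vec n (\<lambda>_. a $ 0))) \<in> ?K \<rightarrow> UNIV \<times> {a \<in> ?K. a $ 0 = 0}"
      using n by (auto simp: mat_kernel_incidence_matrix[OF H] shift)
  qed (use n in \<open>auto simp: mat_kernel_incidence_matrix[OF H]\<close>)
  then have "card ?K = CARD('a) * card {a \<in> ?K. a $ 0 = 0}"
    by (simp add: bij_betw_same_card[symmetric] card_cartesian_product)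
  moreover define \<psi> where "\<psi> = inv_into UNIV \<chi>"
  have \<psi>: "\<psi> (\<chi> a) = a" "y \<in> range \<chi> \<Longrightarrow> \<chi> (\<psi> y) = y" for a y
    using \<chi>(3) by (auto simp: \<psi>_def f_inv_into_f)
  \<comment> \<open>Entrywise, \<open>\<chi>\<close> turns edge sums into edge products. Injectivity
    makes a product equal to 1 come only from a sum equal to 0.\<close>
  have "bij_betw (map_vec \<chi>) {a \<in> ?K. a $ 0 = 0} ?Y"
  proof (rule bij_betwI[where g = "map_vec \<psi>"])
    have inv: "\<psi> 1 = 0"
      using \<chi>(2) \<psi>(1) by metis
    have prod: "(\<Prod>j\<in>e. map_vec \<chi> a $ j) = \<chi> (\<Sum>j\<in>e. a $ j)"
      if "e \<in> set es" "a \<in> carrier_vec n" for e a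
    proof -
      have "(\<Prod>j\<in>e. map_vec \<chi> a $ j) = (\<Prod>j\<in>e. \<chi> (a $ j))"
        using that e[of e] by (intro prod.cong) auto
      then show ?thesis
        by (simp add: character_sum \<chi>)
    qed
    show "map_vec \<chi> \<in> {a \<in> ?K. a $ 0 = 0} \<rightarrow> ?Y"
      using n by (auto simp: mat_kernel_incidence_matrix[OF H] prod \<chi>)
    have inv_vec: "map_vec \<chi> (map_vec \<psi> y) = y"
      if "y \<in> carrier_vec n" "\<forall>i<n. y $ i \<in> range \<chi>" for y
      using that by (auto simp: \<psi>)
    have "(\<Sum>j\<in>e. map_vec \<psi> y $ j) = 0"
      if "e \<in> set es" "y \<in> ?Y" for e y
    proof -
      have "\<chi> (\<Sum>j\<in>e. map_vec \<psi> y $ j) = \<chi> 0"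
        using that inv_vec[of y] \<chi> prod[of e "map_vec \<psi> y"] by simp
      then show ?thesis
        using \<chi>(3) by (rule injD[rotated])
    qed
    then show "map_vec \<psi> \<in> ?Y \<rightarrow> {a \<in> ?K. a $ 0 = 0}"
      using n inv by (auto simp: mat_kernel_incidence_matrix[OF H])
    show "map_vec \<psi> (map_vec \<chi> a) = a" if "a \<in> {a \<in> ?K. a $ 0 = 0}" for a
      using that by (auto simp: \<psi> mat_kernel_incidence_matrix[OF H])
    show "map_vec \<chi> (map_vec \<psi> y) = y" if "y \<in> ?Y" for y
      using that inv_vec by auto
  qed
  ultimately show ?thesis
    by (simp add: bij_betw_same_card)
qed

section \<open>Additive characters of Z_m and Z_2\<close>

definition root_character :: "'m :: nontriv mod_ring \<Rightarrow> complex" where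
  "root_character x = cis (2 * pi * real_of_int (to_int_mod_ring x) / real CARD('m))"

text \<open>The definition uses the representative below \<open>CARD('m)\<close>. Any natural
  representative may replace it, because the base of the power is a root of unity of that order;
  additivity then reduces to the law of exponents.\<close>

lemma root_character_of_nat:
  "root_character (of_nat k :: 'm :: nontriv mod_ring) = cis (2 * pi / real CARD('m)) ^ k"
proof -
  let ?w = "cis (2 * pi / real CARD('m))"
  have "to_int_mod_ring (of_nat k :: 'm mod_ring) = int (k mod CARD('m))"
    unfolding of_nat_of_int_mod_ring by transfer (simp add: zmod_int)
  then have "root_character (of_nat k :: 'm mod_ring) = ?w ^ (k mod CARD('m))"
    by (simp add: root_character_def DeMoivre mult_ac)
  also have "\<dots> = ?w ^ (k mod CARD('m)) * (?w ^ CARD('m)) ^ (k div CARD('m))"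
    by (simp add: DeMoivre)
  also have "\<dots> = ?w ^ k"
    by (simp flip: power_mult power_add)
  finally show ?thesis .
qed

lemma root_character_add: "root_character (x + y) = root_character x * root_character y"
proof -
  obtain j k where "x = of_nat j" "y = of_nat k"
    using mod_ring_of_nat[of x] mod_ring_of_nat[of y] by metis
  then show ?thesis
    by (simp add: root_character_of_nat power_add flip: of_nat_add)
qed

lemma root_character_0: "root_character 0 = 1"
  using root_character_of_nat[of 0] by simp

lemma bij_betw_root_character:
  "bij_betw (root_character :: 'm :: nontriv mod_ring \<Rightarrow> complex) UNIV {z. z ^ CARD('m) = 1}"
proof -
  have "bij_betw (\<lambda>x :: 'm mod_ring. nat (to_int_mod_ring x)) UNIV {..<CARD('m)}"
  proof (rule bij_betwI[where g = of_nat])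
    have "0 \<le> to_int_mod_ring x" "to_int_mod_ring x < int CARD('m)" for x :: "'m mod_ring"
      using range_to_int_mod_ring[where ?'a = 'm] by auto
    then show "(\<lambda>x :: 'm mod_ring. nat (to_int_mod_ring x)) \<in> UNIV \<rightarrow> {..<CARD('m)}"
      and "of_nat (nat (to_int_mod_ring x)) = x" for x :: "'m mod_ring"
      by (auto simp: of_nat_of_int_mod_ring nat_less_iff)
  qed (auto simp: of_nat_of_int_mod_ring)
  from bij_betw_trans[OF this bij_betw_roots_unity]
  have "bij_betw ((\<lambda>k. cis (2 * pi * real k / real CARD('m))) \<circ> (\<lambda>x :: 'm mod_ring. nat (to_int_mod_ring x)))
      UNIV {z. z ^ CARD('m) = 1}"
    by simp
  moreover have "0 \<le> to_int_mod_ring x" for x :: "'m mod_ring"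
    using range_to_int_mod_ring[where ?'a = 'm] by auto
  ultimately show ?thesis
    by (simp add: root_character_def[abs_def] comp_def)
qed

text \<open>The nontrivial additive character of Z_2. For even m its values are exactly the real
  m-th roots of unity.\<close>

definition sign_character :: "bit \<Rightarrow> complex" where
  "sign_character b = (if b = 0 then 1 else -1)"

text \<open>The kernel counts are stated for finite ring types and are applied to
  \<open>bit\<close>.\<close>

instance bit :: finite
proof
  have "(UNIV :: bit set) = {0, 1}"
    by auto
  then show "finite (UNIV :: bit set)"
    by (metis finite.emptyI finite_insert)
qed

lemma CARD_bit: "CARD(bit) = 2"
proof -
  have "(UNIV :: bit set) = {0, 1}"
    by auto
  then show ?thesis
    by (simp only: card_2_iff) auto
qed

lemma sign_character_add: "sign_character (a + b) = sign_character a * sign_character b"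
  by (cases a; cases b) (simp_all add: sign_character_def)

lemma range_sign_character: "range sign_character = {1, -1}"
  by (auto simp: sign_character_def image_def intro: exI[of _ "0 :: bit"] exI[of _ "1 :: bit"])

lemma inj_sign_character: "inj sign_character"
  by (auto simp: inj_def sign_character_def split: if_splits)

section \<open>Eigenvectors for the eigenvalue zero\<close>

text \<open>A list of \<open>m\<close> entries that covers the \<open>m\<close> elements of
  \<open>e\<close> has no repetitions. So the tails following \<open>i\<close> are the
  \<open>(m - 1)!\<close> orderings of the rest of the edge.\<close>

lemma lists_of_edge:
  assumes "card e = m" "finite e" "i \<in> e"
  shows "{js. length js = m - 1 \<and> set (i # js) = e} = permutations_of_set (e - {i})"
proof (rule Set.set_eqI, rule iffI)
  fix js assume "js \<in> {js. length js = m - 1 \<and> set (i # js) = e}"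
  then have js: "length js = m - 1" "set (i # js) = e"
    by auto
  have "card (set (i # js)) = length (i # js)"
    using js assms by (metis One_nat_def Suc_pred' card_gt_0_iff empty_iff length_Cons)
  then have "distinct (i # js)"
    by (rule card_distinct)
  then show "js \<in> permutations_of_set (e - {i})"
    using js by (auto intro: permutations_of_setI)
next
  fix js assume "js \<in> permutations_of_set (e - {i})"
  then have "set js = e - {i}" "distinct js"
    by (auto dest: permutations_of_setD)
  then show "js \<in> {js. length js = m - 1 \<and> set (i # js) = e}"
    using assms distinct_card[of js] by auto
qed

text \<open>Grouping the index lists by the edge they span gives \<open>(m - 1)!\<close> equal
  products for each edge through \<open>i\<close>, which cancels the factor
  \<open>1 / fact (m - 1)\<close> of the tensor.\<close>

lemma tensor_apply_adjacency:
  assumes H: "uniform_hypergraph m n E" and m: "m > 0"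
  shows "tensor_apply m n (adjacency_tensor m E) x i = (\<Sum>e\<in>{e \<in> E. i \<in> e}. \<Prod>j\<in>e - {i}. x $ j)"
proof -
  have e: "e \<subseteq> {..<n}" "card e = m" "finite e" if "e \<in> E" for e
    using H that finite_subset[of e "{..<n}"] by (auto simp: uniform_hypergraph_def)
  have "E \<subseteq> Pow {..<n}"
    using e by auto
  then have finE: "finite E"
    by (rule finite_subset) simp
  let ?J = "{js. length js = m - 1 \<and> set js \<subseteq> {..<n}}"
  let ?P = "\<lambda>e. {js. length js = m - 1 \<and> set (i # js) = e}"
  have finJ: "finite ?J"
    using finite_lists_length_eq[of "{..<n}" "m - 1"] by (simp add: conj_commute)
  have finP: "finite (?P e)" if "e \<in> E" "i \<in> e" for e
    using e[OF that(1)] that by (subst lists_of_edge) auto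
  have "tensor_apply m n (adjacency_tensor m E) x i =
      (\<Sum>js\<in>?J. if set (i # js) \<in> E then 1 / fact (m - 1) * (\<Prod>j\<leftarrow>js. x $ j) else 0)"
    unfolding tensor_apply_def using m
    by (intro sum.cong) (auto simp: adjacency_tensor_def)
  also have "\<dots> = (\<Sum>js\<in>{js \<in> ?J. set (i # js) \<in> E}. 1 / fact (m - 1) * (\<Prod>j\<leftarrow>js. x $ j))"
    by (rule sum.inter_filter[OF finJ, symmetric])
  also have "{js \<in> ?J. set (i # js) \<in> E} = (\<Union>e\<in>{e \<in> E. i \<in> e}. ?P e)"
    using e by fastforce
  also have "(\<Sum>js\<in>\<dots>. 1 / fact (m - 1) * (\<Prod>j\<leftarrow>js. x $ j)) =
      (\<Sum>e\<in>{e \<in> E. i \<in> e}. \<Sum>js\<in>?P e. 1 / fact (m - 1) * (\<Prod>j\<leftarrow>js. x $ j))"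
    using finE finP by (intro sum.UNION_disjoint) auto
  also have "\<dots> = (\<Sum>e\<in>{e \<in> E. i \<in> e}. \<Prod>j\<in>e - {i}. x $ j)"
  proof (intro sum.cong refl)
    fix e' assume e': "e' \<in> {e \<in> E. i \<in> e}"
    have "(\<Sum>js\<in>?P e'. 1 / fact (m - 1) * (\<Prod>j\<leftarrow>js. x $ j)) =
        (\<Sum>js\<in>permutations_of_set (e' - {i}). 1 / fact (m - 1) * (\<Prod>j\<in>e' - {i}. x $ j))"
    proof (intro sum.cong)
      show "?P e' = permutations_of_set (e' - {i})"
        using e e' by (intro lists_of_edge) auto
      fix js assume "js \<in> permutations_of_set (e' - {i})"
      then have js: "set js = e' - {i}" "distinct js"
        by (auto dest: permutations_of_setD)
      show "1 / fact (m - 1) * (\<Prod>j\<leftarrow>js. x $ j) = 1 / fact (m - 1) * (\<Prod>j\<in>e' - {i}. x $ j)"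
        unfolding js(1)[symmetric] prod.distinct_set_conv_list[OF js(2)] ..
    qed
    also have "\<dots> = (\<Prod>j\<in>e' - {i}. x $ j)"
      using e e' by simp
    finally show "(\<Sum>js\<in>?P e'. 1 / fact (m - 1) * (\<Prod>j\<leftarrow>js. x $ j)) = (\<Prod>j\<in>e' - {i}. x $ j)" .
  qed
  finally show ?thesis .
qed

lemma tensor_apply_degree:
  assumes "m > 0" "i < n"
  shows "tensor_apply m n (degree_tensor m E) x i = of_nat (degree_of E i) * x $ i ^ (m - 1)"
proof -
  let ?J = "{js. length js = m - 1 \<and> set js \<subseteq> {..<n}}"
  have finJ: "finite ?J"
    using finite_lists_length_eq[of "{..<n}" "m - 1"] by (simp add: conj_commute)
  have "i # js = replicate m i \<longleftrightarrow> js = replicate (m - 1) i" for js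
    using assms by (cases m) auto
  then have "tensor_apply m n (degree_tensor m E) x i =
      (\<Sum>js\<in>?J. if js = replicate (m - 1) i then of_nat (degree_of E i) * x $ i ^ (m - 1) else 0)"
    unfolding tensor_apply_def
    by (intro sum.cong) (auto simp: degree_tensor_def prod_list_replicate)
  also have "\<dots> = of_nat (degree_of E i) * x $ i ^ (m - 1)"
    using finJ assms by (auto simp: set_replicate_conv_if)
  finally show ?thesis .
qed

text \<open>The scalar \<open>s\<close> covers both tensors: \<open>s = 1\<close> is the Laplacian
  and \<open>s = -1\<close> the signless Laplacian.\<close>

lemma eigenvector_of_0_iff:
  assumes H: "uniform_hypergraph m n E" and m: "m > 0"
    and T: "\<And>ix. T ix = degree_tensor m E ix - s * adjacency_tensor m E ix"
  shows "eigenvector_of m n T 0 x \<longleftrightarrow> x \<in> carrier_vec n \<and> x \<noteq> 0\<^sub>v n \<and>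
    (\<forall>i<n. of_nat (degree_of E i) * x $ i ^ (m - 1) =
      (\<Sum>e\<in>{e \<in> E. i \<in> e}. s * (\<Prod>j\<in>e - {i}. x $ j)))"
proof -
  have "tensor_apply m n T x i = tensor_apply m n (degree_tensor m E) x i -
      s * tensor_apply m n (adjacency_tensor m E) x i" for i
    by (simp add: tensor_apply_def T sum_distrib_left algebra_simps flip: sum_subtractf)
  then show ?thesis
    using m by (simp add: eigenvector_of_def tensor_apply_degree tensor_apply_adjacency[OF H m]
        sum_distrib_left)
qed

text \<open>The equality case of the triangle inequality. The numbers
  \<open>norm w ^ 2 - Re (f b * cnj w)\<close> are nonnegative and sum to 0, so each vanishes;
  expanding \<open>norm (f a - w) ^ 2\<close> then leaves at most 0.\<close>

lemma sum_eq_card_mult_imp_eq: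
  fixes f :: "'a \<Rightarrow> complex"
  assumes "finite F" and sum: "(\<Sum>a\<in>F. f a) = of_nat (card F) * w"
    and le: "\<And>a. a \<in> F \<Longrightarrow> norm (f a) \<le> norm w" and "a \<in> F"
  shows "f a = w"
proof -
  have nonneg: "norm w ^ 2 - Re (f b * cnj w) \<ge> 0" if "b \<in> F" for b
    using complex_Re_le_cmod[of "f b * cnj w"] mult_right_mono[OF le[OF that] norm_ge_zero[of w]]
    by (simp add: power2_eq_square norm_mult)
  have "(\<Sum>b\<in>F. norm w ^ 2 - Re (f b * cnj w)) = card F * norm w ^ 2 - Re ((\<Sum>b\<in>F. f b) * cnj w)"
    by (simp only: sum_subtractf sum_distrib_right Re_sum sum_constant)
  also have "\<dots> = 0"
    unfolding sum cmod_power2 by (simp add: power2_eq_square algebra_simps)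
  finally have "norm w ^ 2 - Re (f a * cnj w) = 0"
    using nonneg \<open>finite F\<close> \<open>a \<in> F\<close> by (simp add: sum_nonneg_eq_0_iff)
  moreover have "norm (f a - w) ^ 2 = norm (f a) ^ 2 + norm w ^ 2 - 2 * Re (f a * cnj w)"
    unfolding cmod_power2 by (simp add: power2_eq_square algebra_simps)
  moreover have "norm (f a) ^ 2 \<le> norm w ^ 2"
    using le[OF \<open>a \<in> F\<close>] by (simp add: power_mono)
  ultimately have "norm (f a - w) ^ 2 \<le> 0"
    by linarith
  then show ?thesis
    by simp
qed

lemma connected_hypergraph_induct [consumes 3, case_names root edge]:
  assumes "connected_hypergraph n E" "u < n" "v < n" and "P u"
    and "\<And>e a b. e \<in> E \<Longrightarrow> a \<in> e \<Longrightarrow> b \<in> e \<Longrightarrow> P a \<Longrightarrow> P b"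
  shows "P v"
proof -
  have "(u, v) \<in> {(a, b). \<exists>e\<in>E. a \<in> e \<and> b \<in> e}\<^sup>*"
    using assms by (auto simp: connected_hypergraph_def)
  then show ?thesis
    by induction (use assms in auto)
qed

text \<open>At a coordinate of maximal modulus the triangle inequality is an equality, which forces the
  neighbouring coordinates to have maximal modulus as well; connectedness spreads this to all
  vertices.\<close>

lemma eigenvector_edge_condition:
  fixes x :: "complex vec"
  assumes H: "uniform_hypergraph m n E" and conn: "connected_hypergraph n E" and m: "m > 0"
    and s: "norm s = 1" and x: "x \<in> carrier_vec n" "x \<noteq> 0\<^sub>v n"
    and eq: "\<And>i. i < n \<Longrightarrow> of_nat (degree_of E i) * x $ i ^ (m - 1) =
      (\<Sum>e\<in>{e \<in> E. i \<in> e}. s * (\<Prod>j\<in>e - {i}. x $ j))"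
  shows "\<forall>i<n. x $ i \<noteq> 0"
    and "\<forall>e\<in>E. \<forall>i\<in>e. x $ i ^ m = s * (\<Prod>j\<in>e. x $ j)"
proof -
  have e: "e \<subseteq> {..<n}" "card e = m" "finite e" if "e \<in> E" for e
    using H that finite_subset[of e "{..<n}"] by (auto simp: uniform_hypergraph_def)
  have "E \<subseteq> Pow {..<n}"
    using e by auto
  then have finE: "finite E"
    by (rule finite_subset) simp
  have n: "n > 0"
    using H by (simp add: uniform_hypergraph_def)
  define M where "M = Max ((\<lambda>i. norm (x $ i)) ` {..<n})"
  have le: "norm (x $ i) \<le> M" if "i < n" for i
    using that by (auto simp: M_def)
  obtain k where k: "k < n" "norm (x $ k) = M"
  proof -
    have "M \<in> (\<lambda>i. norm (x $ i)) ` {..<n}"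
      unfolding M_def using n by (intro Max_in) auto
    then show ?thesis
      using that by auto
  qed
  obtain l where "l < n" "x $ l \<noteq> 0"
    using x by (auto simp: vec_eq_iff)
  then have M: "M > 0"
    using le[of l] by (smt (verit) zero_less_norm_iff)
  have prod_le: "norm (\<Prod>j\<in>e - {i}. x $ j) \<le> M ^ (m - 1)" if "e \<in> E" "i \<in> e" for e i
  proof -
    have "(\<Prod>j\<in>e - {i}. norm (x $ j)) \<le> (\<Prod>j\<in>e - {i}. M)"
      using e(1)[OF that(1)] le by (intro prod_mono) auto
    then show ?thesis
      using e that by (simp add: prod_norm)
  qed
  \<comment> \<open>At a coordinate of modulus \<open>M\<close> the edge terms have modulus at most
    \<open>M ^ (m - 1)\<close>, and their average is \<open>x $ i ^ (m - 1)\<close>, of exactly that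
    modulus; hence every term equals the average.\<close>
  have local: "s * (\<Prod>j\<in>e - {i}. x $ j) = x $ i ^ (m - 1)"
    if "e \<in> E" "i \<in> e" "norm (x $ i) = M" for e i
  proof (rule sum_eq_card_mult_imp_eq[of "{e \<in> E. i \<in> e}" "\<lambda>e. s * (\<Prod>j\<in>e - {i}. x $ j)"])
    have "i < n"
      using e(1)[OF that(1)] that(2) by auto
    then show "(\<Sum>e\<in>{e \<in> E. i \<in> e}. s * (\<Prod>j\<in>e - {i}. x $ j)) =
        of_nat (card {e \<in> E. i \<in> e}) * x $ i ^ (m - 1)"
      using eq[of i] by (simp add: degree_of_def)
    show "norm (s * (\<Prod>j\<in>e' - {i}. x $ j)) \<le> norm (x $ i ^ (m - 1))"
      if "e' \<in> {e \<in> E. i \<in> e}" for e'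
      using prod_le[of e' i] that s \<open>norm (x $ i) = M\<close> by (simp add: norm_mult norm_power)
  qed (use finE that in auto)
  have all_M: "norm (x $ v) = M" if "v < n" for v
    using conn k(1) that
  proof (induction rule: connected_hypergraph_induct)
    case root
    show ?case by (rule k)
  next
    case (edge e a b)
    show ?case
    proof (cases "a = b")
      case False
      \<comment> \<open>Splitting off the factor at \<open>b\<close> leaves \<open>m - 2\<close>
        factors of modulus at most \<open>M\<close>, so \<open>norm (x $ b)\<close> cannot fall
        below \<open>M\<close>.\<close>
      have "norm (\<Prod>j\<in>e - {a}. x $ j) = M ^ (m - 1)"
        using arg_cong[OF local[OF edge(1,2,4)], of norm] s edge(4)
        by (simp add: norm_mult norm_power)
      moreover have "norm (\<Prod>j\<in>e - {a}. x $ j) = norm (x $ b) * norm (\<Prod>j\<in>e - {a} - {b}. x $ j)"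
        using False edge e[of e] by (subst prod.remove[of _ b]) (auto simp: norm_mult)
      moreover have "norm (\<Prod>j\<in>e - {a} - {b}. x $ j) \<le> M ^ (m - 2)"
      proof -
        have "(\<Prod>j\<in>e - {a} - {b}. norm (x $ j)) \<le> M ^ card (e - {a} - {b})"
          unfolding prod_constant[symmetric] using e[of e] edge le by (intro prod_mono) auto
        also have "card (e - {a} - {b}) = m - 2"
          using False edge e[of e] by simp
        finally show ?thesis
          by (simp add: prod_norm)
      qed
      moreover have "m \<ge> 2"
        using False edge e[of e] card_mono[of e "{a, b}"] by auto
      moreover from this have "M ^ (m - 1) = M * M ^ (m - 2)"
        by (simp add: power_eq_if numeral_2_eq_2)
      ultimately have "M * M ^ (m - 2) \<le> norm (x $ b) * M ^ (m - 2)"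
        by (metis mult_left_mono norm_ge_zero)
      then have "M \<le> norm (x $ b)"
        using M by simp
      then show ?thesis
        using le[of b] edge e[of e] by force
    qed (use edge in simp)
  qed
  show "\<forall>i<n. x $ i \<noteq> 0"
    using all_M M by fastforce
  show "\<forall>e\<in>E. \<forall>i\<in>e. x $ i ^ m = s * (\<Prod>j\<in>e. x $ j)"
  proof safe
    fix e' i assume i: "e' \<in> E" "i \<in> e'"
    \<comment> \<open>Multiplying the local identity by \<open>x $ i\<close> completes the product
      to the whole edge, so that side no longer depends on \<open>i\<close>.\<close>
    have "(\<Prod>j\<in>e'. x $ j) = x $ i * (\<Prod>j\<in>e' - {i}. x $ j)"
      using i e[of e'] by (intro prod.remove) auto
    then have "s * (\<Prod>j\<in>e'. x $ j) = x $ i * x $ i ^ (m - 1)"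
      using local[OF i] all_M i e[of e'] by (auto simp: mult_ac)
    then show "x $ i ^ m = s * (\<Prod>j\<in>e'. x $ j)"
      using m by (cases m) auto
  qed
qed

text \<open>The condition \<open>y $ 0 = 1\<close> selects one vector on each line of eigenvectors,
  which is possible because no coordinate of an eigenvector vanishes.\<close>

definition root_solutions :: "nat \<Rightarrow> nat \<Rightarrow> nat set set \<Rightarrow> complex \<Rightarrow> complex vec set" where
  "root_solutions m n E s = {y \<in> carrier_vec n. y $ 0 = 1 \<and> (\<forall>i<n. y $ i ^ m = 1) \<and>
    (\<forall>e\<in>E. (\<Prod>j\<in>e. y $ j) = s)}"

text \<open>For an eigenvector, \<open>x $ i ^ m\<close> is constant on each edge and so, by
  connectedness, everywhere; dividing by \<open>x $ 0\<close> yields roots of unity. Conversely, for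
  a multiple of a solution each edge at \<open>i\<close> contributes exactly
  \<open>x $ i ^ (m - 1)\<close>, which makes the sum the degree times this power.\<close>

lemma eigenvector_of_0_iff_root_solution:
  assumes H: "uniform_hypergraph m n E" and conn: "connected_hypergraph n E" and m: "m > 0"
    and T: "\<And>ix. T ix = degree_tensor m E ix - s * adjacency_tensor m E ix"
    and s: "s * s = 1"
  shows "eigenvector_of m n T 0 x \<longleftrightarrow> (\<exists>c. c \<noteq> 0 \<and> (\<exists>y\<in>root_solutions m n E s. x = c \<cdot>\<^sub>v y))"
proof
  have e: "e \<subseteq> {..<n}" "card e = m" "finite e" if "e \<in> E" for e
    using H that finite_subset[of e "{..<n}"] by (auto simp: uniform_hypergraph_def)
  have n: "n > 0"
    using H by (simp add: uniform_hypergraph_def)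
  have norm_s: "norm s = 1"
    using s by (auto simp: square_eq_1_iff)
  {
    assume "eigenvector_of m n T 0 x"
    then have x: "x \<in> carrier_vec n" "x \<noteq> 0\<^sub>v n"
      and eq: "\<And>i. i < n \<Longrightarrow> of_nat (degree_of E i) * x $ i ^ (m - 1) =
        (\<Sum>e\<in>{e \<in> E. i \<in> e}. s * (\<Prod>j\<in>e - {i}. x $ j))"
      by (auto simp: eigenvector_of_0_iff[OF H m T])
    note nz = eigenvector_edge_condition(1)[OF H conn m norm_s x eq]
    note edge_eq = eigenvector_edge_condition(2)[OF H conn m norm_s x eq]
    have pow: "x $ i ^ m = x $ 0 ^ m" if "i < n" for i
      using conn n that
    proof (induction rule: connected_hypergraph_induct)
      case (edge e a b)
      then show ?case
        using edge_eq by metis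
    qed simp
    define y where "y = inverse (x $ 0) \<cdot>\<^sub>v x"
    have y: "y $ i = x $ i / x $ 0" if "i < n" for i
      using that x by (simp add: y_def divide_inverse mult.commute)
    have "(\<Prod>j\<in>e'. y $ j) = s" if "e' \<in> E" for e'
    proof -
      obtain i where i: "i \<in> e'"
        using e(2)[OF \<open>e' \<in> E\<close>] m by fastforce
      have "(\<Prod>j\<in>e'. y $ j) = (\<Prod>j\<in>e'. x $ j / x $ 0)"
        using e[OF that] y by (intro prod.cong) auto
      also have "\<dots> = (\<Prod>j\<in>e'. x $ j) / x $ 0 ^ m"
        using e[OF that] by (simp add: prod_dividef)
      \<comment> \<open>Inserting \<open>s * s = 1\<close> produces the expression that the edge
        equation evaluates.\<close>
      also have "\<dots> = s * (s * (\<Prod>j\<in>e'. x $ j)) / x $ 0 ^ m"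
        using s by (simp add: mult.assoc[symmetric])
      also have "s * (\<Prod>j\<in>e'. x $ j) = x $ 0 ^ m"
        using edge_eq that i pow[of i] e[OF that] by auto
      finally show ?thesis
        using nz n by simp
    qed
    moreover have "y $ i ^ m = 1" if "i < n" for i
      using y[OF that] pow[OF that] nz n by (simp add: power_divide)
    moreover have "y \<in> carrier_vec n" "y $ 0 = 1"
      using x y[of 0] nz n by (auto simp: y_def)
    ultimately have "y \<in> root_solutions m n E s"
      unfolding root_solutions_def by blast
    moreover have "x = x $ 0 \<cdot>\<^sub>v y"
      using x n nz by (auto simp: y_def smult_smult_assoc)
    ultimately show "\<exists>c. c \<noteq> 0 \<and> (\<exists>y\<in>root_solutions m n E s. x = c \<cdot>\<^sub>v y)"
      using n nz by blast
  }
  assume "\<exists>c. c \<noteq> 0 \<and> (\<exists>y\<in>root_solutions m n E s. x = c \<cdot>\<^sub>v y)"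
  then obtain c y where c: "c \<noteq> 0" and y: "y \<in> carrier_vec n" "y $ 0 = 1"
    "\<And>i. i < n \<Longrightarrow> y $ i ^ m = 1" "\<And>e. e \<in> E \<Longrightarrow> (\<Prod>j\<in>e. y $ j) = s" and x: "x = c \<cdot>\<^sub>v y"
    by (auto simp: root_solutions_def)
  have "s * (\<Prod>j\<in>e' - {i}. x $ j) = x $ i ^ (m - 1)" if i: "e' \<in> E" "i \<in> e'" for e' i
  proof -
    have [simp]: "i < n"
      using i e by auto
    have "(\<Prod>j\<in>e' - {i}. x $ j) = (\<Prod>j\<in>e' - {i}. c * y $ j)"
      using e[OF i(1)] y(1) by (intro prod.cong) (auto simp: x)
    also have "\<dots> = c ^ (m - 1) * (\<Prod>j\<in>e' - {i}. y $ j)"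
      using e[OF i(1)] i by (simp add: prod.distrib)
    \<comment> \<open>The factor \<open>y $ i\<close> completes the edge product so that its value
      \<open>s\<close> can be used; being a root of unity, it is cancelled afterwards.\<close>
    finally have "y $ i * (s * (\<Prod>j\<in>e' - {i}. x $ j)) = c ^ (m - 1) * s * (y $ i * (\<Prod>j\<in>e' - {i}. y $ j))"
      by (simp add: mult_ac)
    also have "y $ i * (\<Prod>j\<in>e' - {i}. y $ j) = s"
      using i e[of e'] y(4) by (subst prod.remove[symmetric]) auto
    also have "c ^ (m - 1) * s * s = y $ i * (c * y $ i) ^ (m - 1)"
      using s y(3)[of i] m by (cases m) (auto simp: power_mult_distrib mult_ac)
    finally have "y $ i * (s * (\<Prod>j\<in>e' - {i}. x $ j)) = y $ i * x $ i ^ (m - 1)"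
      using y(1) by (simp add: x)
    moreover have "y $ i \<noteq> 0"
      using y(3)[of i] m by (auto simp: power_0_left)
    ultimately show ?thesis
      by simp
  qed
  moreover have "x \<noteq> 0\<^sub>v n"
    using c y n by (auto simp: x vec_eq_iff)
  ultimately show "eigenvector_of m n T 0 x"
    using y(1) by (auto simp: eigenvector_of_0_iff[OF H m T] degree_of_def x)
qed

section \<open>Counting points of projective space\<close>

text \<open>Comparing first coordinates gives \<open>c = d * z $ 0\<close>, so \<open>y $ i\<close>
  is the real quotient \<open>z $ i / z $ 0\<close>. Being an H-eigenvector thus becomes a condition
  on the normalized representative alone.\<close>

lemma vec_real_multiple_iff:
  fixes y :: "complex vec"
  assumes "n > 0" "y \<in> carrier_vec n" "y $ 0 = 1" "c \<noteq> 0"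
  shows "(\<exists>d. \<exists>z\<in>carrier_vec n. c \<cdot>\<^sub>v y = d \<cdot>\<^sub>v map_vec complex_of_real z) \<longleftrightarrow>
    (\<forall>i<n. y $ i \<in> \<real>)"
proof
  assume "\<forall>i<n. y $ i \<in> \<real>"
  then have "c \<cdot>\<^sub>v y = c \<cdot>\<^sub>v map_vec complex_of_real (map_vec Re y)"
    using assms by auto
  then show "\<exists>d. \<exists>z\<in>carrier_vec n. c \<cdot>\<^sub>v y = d \<cdot>\<^sub>v map_vec complex_of_real z"
    using assms by (metis map_carrier_vec)
next
  assume "\<exists>d. \<exists>z\<in>carrier_vec n. c \<cdot>\<^sub>v y = d \<cdot>\<^sub>v map_vec complex_of_real z"
  then obtain d z where z: "z \<in> carrier_vec n" "c \<cdot>\<^sub>v y = d \<cdot>\<^sub>v map_vec complex_of_real z"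
    by auto
  have eq: "c * y $ i = d * complex_of_real (z $ i)" if "i < n" for i
  proof -
    have "(c \<cdot>\<^sub>v y) $ i = (d \<cdot>\<^sub>v map_vec complex_of_real z) $ i"
      by (simp only: z(2))
    then show ?thesis
      using that assms(2) z(1) by simp
  qed
  show "\<forall>i<n. y $ i \<in> \<real>"
  proof safe
    fix i assume i: "i < n"
    have c: "c = d * complex_of_real (z $ 0)"
      using eq[of 0] assms by simp
    then have "complex_of_real (z $ 0) * y $ i = complex_of_real (z $ i)" "z $ 0 \<noteq> 0"
      using eq[OF i] \<open>c \<noteq> 0\<close> by auto
    then have "y $ i = complex_of_real (z $ i / z $ 0)"
      by (simp add: field_simps)
    then show "y $ i \<in> \<real>"
      by simp
  qed
qed

lemma equiv_proportional: "equiv UNIV proportional"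
proof (intro equivI)
  show "refl proportional"
    by (auto simp: refl_on_def proportional_def intro: exI[of _ 1])
  show "sym proportional"
  proof (rule symI)
    fix x y assume "(x, y) \<in> proportional"
    then obtain c where c: "c \<noteq> 0" "y = c \<cdot>\<^sub>v x"
      by (auto simp: proportional_def)
    then show "(y, x) \<in> proportional"
      by (auto simp: proportional_def smult_smult_assoc intro!: exI[of _ "inverse c"])
  qed
  show "trans proportional"
  proof (rule transI)
    fix x y z assume "(x, y) \<in> proportional" "(y, z) \<in> proportional"
    then obtain c d where "c \<noteq> 0" "d \<noteq> 0" "y = c \<cdot>\<^sub>v x" "z = d \<cdot>\<^sub>v y"
      by (auto simp: proportional_def)
    then show "(x, z) \<in> proportional"
      by (auto simp: proportional_def smult_smult_assoc intro!: exI[of _ "d * c"])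
  qed
qed auto

text \<open>Whether \<open>c \<cdot>\<^sub>v y\<close> is an H-eigenvector depends only on
  \<open>y\<close>, so the points counted correspond to the solutions with some non-real
  entry.\<close>

lemma N_eigenvector_points_root_solutions:
  assumes H: "uniform_hypergraph m n E" and conn: "connected_hypergraph n E" and m: "m > 0"
    and T: "\<And>ix. T ix = degree_tensor m E ix - s * adjacency_tensor m E ix"
    and s: "s * s = 1"
  shows "H_eigenvalue m n T 0 \<longleftrightarrow> (\<exists>y\<in>root_solutions m n E s. \<forall>i<n. y $ i \<in> \<real>)"
    and "has_number (first_N_eigenvector_points m n T)
      (real (card (root_solutions m n E s)) -
       real (card {y \<in> root_solutions m n E s. \<forall>i<n. y $ i \<in> \<real>}))"
proof -
  have n: "n > 0"
    using H by (simp add: uniform_hypergraph_def)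
  let ?S = "root_solutions m n E s"
  let ?R = "{y \<in> ?S. \<forall>i<n. y $ i \<in> \<real>}"
  have S: "y \<in> carrier_vec n" "y $ 0 = 1" if "y \<in> ?S" for y
    using that by (auto simp: root_solutions_def)
  \<comment> \<open>All solutions lie in this box of tuples of roots of unity; its positive
    cardinality shows that it is finite, as the subtraction of cardinalities requires.\<close>
  have "card {y \<in> carrier_vec n. \<forall>i<n. y $ i \<in> {z :: complex. z ^ m = 1}} = (\<Prod>i<n. card {z :: complex. z ^ m = 1})"
    by (rule card_vec_PiE)
  also have "\<dots> > 0"
    using m by (simp add: card_roots_unity_eq)
  finally have "finite {y \<in> carrier_vec n. \<forall>i<n. y $ i \<in> {z :: complex. z ^ m = 1}}"
    by (rule card_ge_0_finite)
  then have fin: "finite ?S"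
    by (rule finite_subset[rotated]) (auto simp: root_solutions_def)
  note ev = eigenvector_of_0_iff_root_solution[OF H conn m T s]
  have H_iff: "H_eigenvector m n T 0 (c \<cdot>\<^sub>v y) \<longleftrightarrow> (\<forall>i<n. y $ i \<in> \<real>)"
    if "c \<noteq> 0" "y \<in> ?S" for c y
    using that ev[of "c \<cdot>\<^sub>v y"] vec_real_multiple_iff[OF n S[OF that(2)] that(1)]
    unfolding H_eigenvector_def by blast
  have obtain_solution: thesis
    if "eigenvector_of m n T 0 x" "\<And>c y. c \<noteq> 0 \<Longrightarrow> y \<in> ?S \<Longrightarrow> x = c \<cdot>\<^sub>v y \<Longrightarrow> thesis" for x thesis
    using that(1) unfolding ev by (auto intro: that(2))
  show "H_eigenvalue m n T 0 \<longleftrightarrow> (\<exists>y\<in>?S. \<forall>i<n. y $ i \<in> \<real>)"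
  proof
    assume "H_eigenvalue m n T 0"
    then obtain x where x: "H_eigenvector m n T 0 x"
      by (auto simp: H_eigenvalue_def)
    then have "eigenvector_of m n T 0 x"
      by (simp add: H_eigenvector_def)
    then obtain c y where "c \<noteq> 0" "y \<in> ?S" "x = c \<cdot>\<^sub>v y"
      by (rule obtain_solution)
    then show "\<exists>y\<in>?S. \<forall>i<n. y $ i \<in> \<real>"
      using x H_iff by auto
  next
    assume "\<exists>y\<in>?S. \<forall>i<n. y $ i \<in> \<real>"
    then obtain y where "y \<in> ?S" "\<forall>i<n. y $ i \<in> \<real>"
      by auto
    then have "H_eigenvector m n T 0 (1 \<cdot>\<^sub>v y)"
      using H_iff[of 1 y] by simp
    then show "H_eigenvalue m n T 0"
      by (auto simp: H_eigenvalue_def)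
  qed
  have N: "{x. N_eigenvector m n T 0 x} = {c \<cdot>\<^sub>v y |c y. c \<noteq> 0 \<and> y \<in> ?S - ?R}"
  proof (intro subset_antisym subsetI)
    fix x assume "x \<in> {x. N_eigenvector m n T 0 x}"
    then have x: "eigenvector_of m n T 0 x" "\<not> H_eigenvector m n T 0 x"
      by (auto simp: N_eigenvector_def)
    from x(1) obtain c y where "c \<noteq> 0" "y \<in> ?S" "x = c \<cdot>\<^sub>v y"
      by (rule obtain_solution)
    then show "x \<in> {c \<cdot>\<^sub>v y |c y. c \<noteq> 0 \<and> y \<in> ?S - ?R}"
      using x(2) H_iff by blast
  next
    fix x assume "x \<in> {c \<cdot>\<^sub>v y |c y. c \<noteq> 0 \<and> y \<in> ?S - ?R}"
    then obtain c y where "c \<noteq> 0" "y \<in> ?S" "\<not> (\<forall>i<n. y $ i \<in> \<real>)" "x = c \<cdot>\<^sub>v y"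
      by blast
    then show "x \<in> {x. N_eigenvector m n T 0 x}"
      using H_iff ev by (auto simp: N_eigenvector_def)
  qed
  have cls: "proportional `` {c \<cdot>\<^sub>v y} = proportional `` {y}" if "c \<noteq> 0" for c y
    using that by (intro equiv_class_eq[OF equiv_proportional, symmetric]) (auto simp: proportional_def)
  have "first_N_eigenvector_points m n T = (\<lambda>y. proportional `` {y}) ` (?S - ?R)"
  proof (intro subset_antisym subsetI)
    fix X assume "X \<in> first_N_eigenvector_points m n T"
    then obtain c y where "c \<noteq> 0" "y \<in> ?S - ?R" "X = proportional `` {c \<cdot>\<^sub>v y}"
      unfolding first_N_eigenvector_points_def N quotient_def by blast
    then show "X \<in> (\<lambda>y. proportional `` {y}) ` (?S - ?R)"
      using cls by auto
  next
    fix X assume "X \<in> (\<lambda>y. proportional `` {y}) ` (?S - ?R)"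
    then obtain y where y: "y \<in> ?S - ?R" "X = proportional `` {y}"
      by blast
    then have "1 \<cdot>\<^sub>v y \<in> {c \<cdot>\<^sub>v y |c y. c \<noteq> 0 \<and> y \<in> ?S - ?R}"
      by (intro CollectI exI[of _ 1] exI[of _ y]) auto
    then show "X \<in> first_N_eigenvector_points m n T"
      unfolding first_N_eigenvector_points_def N y(2) by (auto intro!: quotientI)
  qed
  moreover have "inj_on (\<lambda>y. proportional `` {y}) (?S - ?R)"
  proof (rule inj_onI)
    fix y z assume yz: "y \<in> ?S - ?R" "z \<in> ?S - ?R" "proportional `` {y} = proportional `` {z}"
    then obtain c where c: "z = c \<cdot>\<^sub>v y"
      using eq_equiv_class[OF yz(3) equiv_proportional] by (auto simp: proportional_def)
    \<comment> \<open>Both first coordinates are 1.\<close>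
    then have "c = 1"
      using S[of y] S[of z] yz n by auto
    then show "y = z"
      using c by simp
  qed
  moreover have "real (card (?S - ?R)) = real (card ?S) - real (card ?R)"
    using fin by (subst card_Diff_subset) (auto intro!: of_nat_diff card_mono)
  ultimately show "has_number (first_N_eigenvector_points m n T) (real (card ?S) - real (card ?R))"
    using fin by (simp add: has_number_def card_image)
qed

text \<open>Entrywise division by a fixed solution \<open>w\<close> changes every edge product from
  \<open>s\<close> to 1. The set \<open>K\<close> lets one argument count all solutions
  (\<open>K = UNIV\<close>) and the real ones (\<open>K = \<real>\<close>); in the latter case
  \<open>w\<close> itself must be real.\<close>

lemma card_root_solutions_translate:
  assumes H: "uniform_hypergraph m n E" and m: "m > 0" and w: "w \<in> root_solutions m n E s"
    and K: "\<And>a b. a \<in> K \<Longrightarrow> b \<in> K \<Longrightarrow> a * b \<in> K" "\<And>a b. a \<in> K \<Longrightarrow> b \<in> K \<Longrightarrow> a / b \<in> K"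
    and wK: "\<And>i. i < n \<Longrightarrow> w $ i \<in> K"
  shows "card {y \<in> root_solutions m n E s. \<forall>i<n. y $ i \<in> K} =
    card {y \<in> root_solutions m n E 1. \<forall>i<n. y $ i \<in> K}"
proof -
  have e: "e \<subseteq> {..<n}" if "e \<in> E" for e
    using H that by (auto simp: uniform_hypergraph_def)
  have n: "n > 0"
    using H by (simp add: uniform_hypergraph_def)
  have w': "w \<in> carrier_vec n" "w $ 0 = 1" "\<And>i. i < n \<Longrightarrow> w $ i ^ m = 1"
    "\<And>e. e \<in> E \<Longrightarrow> (\<Prod>j\<in>e. w $ j) = s"
    using w by (auto simp: root_solutions_def)
  have nz: "w $ i \<noteq> 0" if "i < n" for i
    using w'(3)[OF that] m by (auto simp: power_0_left)
  have prods: "(\<Prod>j\<in>e. vec n (\<lambda>i. y $ i / w $ i) $ j) = (\<Prod>j\<in>e. y $ j) / s"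
    "(\<Prod>j\<in>e. vec n (\<lambda>i. y $ i * w $ i) $ j) = (\<Prod>j\<in>e. y $ j) * s"
    if "e \<in> E" for e and y :: "complex vec"
  proof -
    have "(\<Prod>j\<in>e. vec n (\<lambda>i. y $ i / w $ i) $ j) = (\<Prod>j\<in>e. y $ j / w $ j)"
      using e[OF that] by (intro prod.cong) auto
    then show "(\<Prod>j\<in>e. vec n (\<lambda>i. y $ i / w $ i) $ j) = (\<Prod>j\<in>e. y $ j) / s"
      by (simp add: prod_dividef w'(4)[OF that])
    have "(\<Prod>j\<in>e. vec n (\<lambda>i. y $ i * w $ i) $ j) = (\<Prod>j\<in>e. y $ j * w $ j)"
      using e[OF that] by (intro prod.cong) auto
    then show "(\<Prod>j\<in>e. vec n (\<lambda>i. y $ i * w $ i) $ j) = (\<Prod>j\<in>e. y $ j) * s"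
      by (simp add: prod.distrib w'(4)[OF that])
  qed
  \<comment> \<open>Along any edge, \<open>s\<close> is a product of the nonzero entries of
    \<open>w\<close>.\<close>
  have s: "s \<noteq> 0" if "e \<in> E" for e
  proof -
    have "finite e"
      using e[OF that] finite_subset by blast
    then show ?thesis
      using e[OF that] nz by (subst w'(4)[OF that, symmetric]) auto
  qed
  have "bij_betw (\<lambda>y. vec n (\<lambda>i. y $ i / w $ i)) {y \<in> root_solutions m n E s. \<forall>i<n. y $ i \<in> K}
      {y \<in> root_solutions m n E 1. \<forall>i<n. y $ i \<in> K}"
  proof (rule bij_betwI[where g = "\<lambda>y. vec n (\<lambda>i. y $ i * w $ i)"])
    show "(\<lambda>y. vec n (\<lambda>i. y $ i / w $ i)) \<in> {y \<in> root_solutions m n E s. \<forall>i<n. y $ i \<in> K} \<rightarrow>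
        {y \<in> root_solutions m n E 1. \<forall>i<n. y $ i \<in> K}"
      using n w'(2,3) K(2) wK s
      by (auto simp: root_solutions_def power_divide prods)
    show "(\<lambda>y. vec n (\<lambda>i. y $ i * w $ i)) \<in> {y \<in> root_solutions m n E 1. \<forall>i<n. y $ i \<in> K} \<rightarrow>
        {y \<in> root_solutions m n E s. \<forall>i<n. y $ i \<in> K}"
      using n w'(2,3) K(1) wK
      by (auto simp: root_solutions_def power_mult_distrib prods)
  qed (auto simp: root_solutions_def nz)
  then show ?thesis
    by (rule bij_betw_same_card)
qed

section \<open>Real solutions and the resulting counts\<close>

lemma real_root_of_unity:
  assumes "z \<in> \<real>" "z ^ m = 1" "m > 0"
  shows "z = (1 :: complex) \<or> even m \<and> z = -1"
proof -
  obtain a where a: "z = complex_of_real a"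
    using assms(1) by (rule Reals_cases)
  have am: "a ^ m = 1"
    using assms(2) unfolding a by (metis of_real_eq_1_iff of_real_power)
  then have "\<bar>a\<bar> ^ m = 1"
    by (simp flip: power_abs)
  then have "\<bar>a\<bar> = 1"
    using power_eq_imp_eq_base[of "\<bar>a\<bar>" m 1] assms(3) by simp
  then have "a = 1 \<or> a = -1"
    by linarith
  then show ?thesis
    using am by (auto simp: a minus_one_power_iff split: if_splits)
qed

text \<open>An edge would give \<open>(-1) ^ m = 1\<close> on taking the m-th power of its product,
  impossible for odd \<open>m\<close>; so with edges there is no solution at all. Without edges,
  connectedness leaves the single vertex 0, where the entry is 1.\<close>

lemma root_solutions_minus_1_real:
  assumes H: "uniform_hypergraph m n E" and conn: "connected_hypergraph n E" and m: "odd m"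
    and y: "y \<in> root_solutions m n E (-1)" and i: "i < n"
  shows "y $ i \<in> \<real>"
proof (cases "E = {}")
  case True
  have n: "0 < n"
    using H by (simp add: uniform_hypergraph_def)
  have "i = 0"
    using conn n i by (induction rule: connected_hypergraph_induct) (use True in auto)
  then show ?thesis
    using y by (simp add: root_solutions_def)
next
  case False
  then obtain e where e: "e \<in> E"
    by auto
  have "(-1) ^ m = (\<Prod>j\<in>e. y $ j ^ m)"
    using y e by (auto simp: root_solutions_def prod_power_distrib[symmetric])
  also have "\<dots> = 1"
    using y e H by (intro prod.neutral) (auto simp: root_solutions_def uniform_hypergraph_def)
  finally show ?thesis
    using m by simp
qed

text \<open>The range of \<open>root_character\<close> is the set of all m-th roots of unity, so the
  kernel has \<open>m\<close> times as many elements as there are solutions. Cancelling this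
  \<open>m\<close> lowers the exponent of the Smith count by one.\<close>

lemma card_root_solutions_1:
  fixes es :: "nat set list"
  assumes m: "CARD('m :: nontriv) = m" and H: "uniform_hypergraph m n (set es)"
    and snf: "has_smith_normal_form (incidence_matrix n es :: 'm mod_ring mat) ds"
  shows "real (card (root_solutions m n (set es) 1)) =
    real m powi (int n - 1 - int (length ds)) * (\<Prod>i<length ds. real (ds ! i))"
proof -
  have range: "range (root_character :: 'm mod_ring \<Rightarrow> complex) = {z. z ^ m = 1}"
    and inj: "inj (root_character :: 'm mod_ring \<Rightarrow> complex)"
    using bij_betw_root_character[where ?'m = 'm] m by (auto simp: bij_betw_def)
  have m0: "m > 0"
    using m zero_less_card_finite[where ?'a = 'm] by simp
  have "card (mat_kernel (incidence_matrix n es :: 'm mod_ring mat)) =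
      m * card (root_solutions m n (set es) 1)"
    using card_kernel_eq_card_character_vectors[OF H _ root_character_add root_character_0 inj] m
      of_nat_card_eq_0[where ?'a = 'm]
    by (simp add: range root_solutions_def)
  with card_mat_kernel_smith[OF incidence_matrix_carrier snf]
  have "real m * real (card (root_solutions m n (set es) 1)) =
      real m powi (int n - int (length ds)) * (\<Prod>i<length ds. real (ds ! i))"
    using m by simp
  moreover have "real m powi (int n - int (length ds)) =
      real m * real m powi (int n - 1 - int (length ds))"
    using m0 power_int_add_1'[of "real m" "int n - 1 - int (length ds)"] by simp
  ultimately show ?thesis
    using m0 by simp
qed

text \<open>For odd \<open>m\<close> the only real m-th root of unity is 1. The all-ones vector is
  the source of the term 1 subtracted in the odd case.\<close>

lemma card_real_root_solutions_1_odd: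
  assumes H: "uniform_hypergraph m n E" and m: "odd m"
  shows "card {y \<in> root_solutions m n E 1. \<forall>i<n. y $ i \<in> \<real>} = 1"
proof -
  have e: "e \<subseteq> {..<n}" if "e \<in> E" for e
    using H that by (auto simp: uniform_hypergraph_def)
  have "{y \<in> root_solutions m n E 1. \<forall>i<n. y $ i \<in> \<real>} = {vec n (\<lambda>_. 1)}"
  proof safe
    fix y assume y: "y \<in> root_solutions m n E 1" "\<forall>i<n. y $ i \<in> \<real>"
    have "y $ i = 1" if "i < n" for i
      using y that real_root_of_unity[of "y $ i" m] m odd_pos[OF m]
      by (auto simp: root_solutions_def)
    then show "y = vec n (\<lambda>_. 1)"
      using y by (intro eq_vecI) (auto simp: root_solutions_def)
  next
    have "(\<Prod>j\<in>e. vec n (\<lambda>_. 1 :: complex) $ j) = 1" if "e \<in> E" for e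
      using e[OF that] by (intro prod.neutral) auto
    then show "vec n (\<lambda>_. 1) \<in> root_solutions m n E 1"
      using H by (auto simp: root_solutions_def uniform_hypergraph_def)
  qed auto
  then show ?thesis
    by simp
qed

text \<open>The real m-th roots of unity are now 1 and -1, the range of
  \<open>sign_character\<close>, so the real solutions are counted by the kernel over Z_2.\<close>

lemma card_real_root_solutions_1_even:
  fixes es :: "nat set list"
  assumes H: "uniform_hypergraph m n (set es)" and m: "even m" "m > 0"
  shows "real (card {y \<in> root_solutions m n (set es) 1. \<forall>i<n. y $ i \<in> \<real>}) =
    2 powi (int n - 1 - int (vec_space.rank (length es) (incidence_matrix n es :: bit mat)))"
    (is "real (card ?R) = 2 powi (_ - 1 - int ?r)")
proof -
  have "y $ i \<in> {1, -1} \<longleftrightarrow> y $ i ^ m = 1 \<and> y $ i \<in> \<real>" for y :: "complex vec" and i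
    using real_root_of_unity[of "y $ i" m] m by auto
  then have R: "?R = {y \<in> carrier_vec n. y $ 0 = 1 \<and> (\<forall>i<n. y $ i \<in> range sign_character) \<and>
      (\<forall>e\<in>set es. (\<Prod>j\<in>e. y $ j) = 1)}"
    unfolding range_sign_character root_solutions_def by blast
  \<comment> \<open>Evenness puts the all-ones vector into the kernel over Z_2, which yields the
    factor 2 below.\<close>
  have "of_nat m = (0 :: bit)"
    using m by (auto elim!: evenE)
  then have "card (mat_kernel (incidence_matrix n es :: bit mat)) = 2 * card ?R"
    using card_kernel_eq_card_character_vectors[OF H _ sign_character_add _ inj_sign_character]
    unfolding R CARD_bit by (simp add: sign_character_def)
  moreover have "real (card (mat_kernel (incidence_matrix n es :: bit mat))) = 2 powi (int n - int ?r)"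
    using card_mat_kernel_rank[OF incidence_matrix_carrier[of n es, where ?'a = bit]]
    by (simp only: CARD_bit of_nat_numeral)
  moreover have "(2 :: real) powi (int n - int ?r) = 2 * 2 powi (int n - 1 - int ?r)"
    using power_int_add_1'[of "2 :: real" "int n - 1 - int ?r"] by simp
  ultimately show ?thesis
    by simp
qed

theorem theorem4p8:
  fixes m n r rbar :: nat and E :: "nat set set" and es :: "nat set list" and ds :: "nat list"
  assumes "CARD('m :: nontriv) = m"
    and "uniform_hypergraph m n E"
    and "connected_hypergraph n E"
    and "distinct es" and "set es = E"
    and "has_smith_normal_form (incidence_matrix n es :: 'm mod_ring mat) ds"
    and "r = length ds"
    and "rbar = vec_space.rank (length es) (incidence_matrix n es :: bit mat)"
  shows
    "(odd m \<longrightarrow>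
       has_number (first_N_eigenvector_points m n (laplacian_tensor m E))
         (real m powi (int n - 1 - int r) * (\<Prod>i<r. real (ds ! i)) - 1) \<and>
       has_number (first_N_eigenvector_points m n (signless_laplacian_tensor m E)) 0) \<and>
     (even m \<longrightarrow>
       has_number (first_N_eigenvector_points m n (laplacian_tensor m E))
         (real m powi (int n - 1 - int r) * (\<Prod>i<r. real (ds ! i))
            - 2 powi (int n - 1 - int rbar)) \<and>
       (H_eigenvalue m n (signless_laplacian_tensor m E) 0 \<longrightarrow>
         has_number (first_N_eigenvector_points m n (signless_laplacian_tensor m E))
           (real m powi (int n - 1 - int r) * (\<Prod>i<r. real (ds ! i))
              - 2 powi (int n - 1 - int rbar)))) \<and>
     (even m \<and> N_eigenvalue m n (signless_laplacian_tensor m E) 0 \<longrightarrow>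
       has_number (first_N_eigenvector_points m n (signless_laplacian_tensor m E))
         (real m powi (int n - 1 - int r) * (\<Prod>i<r. real (ds ! i))))"
proof -
  let ?S = "root_solutions m n E"
  let ?R = "\<lambda>s. {y \<in> ?S s. \<forall>i<n. y $ i \<in> \<real>}"
  let ?L = "laplacian_tensor m E" and ?Q = "signless_laplacian_tensor m E"
  note H = assms(2) and conn = assms(3)
  have m0: "m > 0"
    using assms(1) zero_less_card_finite[where ?'a = 'm] by simp
  have "H_eigenvalue m n ?Q 0 \<longleftrightarrow> (\<exists>y\<in>?S (-1). \<forall>i<n. y $ i \<in> \<real>)"
    by (rule N_eigenvector_points_root_solutions(1)[OF H conn m0]) (simp_all add: signless_laplacian_tensor_def)
  then have HQ: "H_eigenvalue m n ?Q 0 \<longleftrightarrow> ?R (-1) \<noteq> {}"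
    by blast
  have L: "has_number (first_N_eigenvector_points m n ?L) (real (card (?S 1)) - real (card (?R 1)))"
    by (rule N_eigenvector_points_root_solutions(2)[OF H conn m0]) (simp_all add: laplacian_tensor_def)
  have Q: "has_number (first_N_eigenvector_points m n ?Q) (real (card (?S (-1))) - real (card (?R (-1))))"
    by (rule N_eigenvector_points_root_solutions(2)[OF H conn m0]) (simp_all add: signless_laplacian_tensor_def)
  have S1: "real (card (?S 1)) = real m powi (int n - 1 - int r) * (\<Prod>i<r. real (ds ! i))"
    using card_root_solutions_1[OF assms(1) _ assms(6)] H assms(5,7) by simp
  \<comment> \<open>Any solution serves as the translating vector here, whereas the next count needs
    a real one.\<close>
  have S_minus_1: "card (?S (-1)) = card (?S 1)" if "?S (-1) \<noteq> {}"
    using that card_root_solutions_translate[OF H m0, where K = UNIV] by auto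
  have R_minus_1: "card (?R (-1)) = card (?R 1)" if "?R (-1) \<noteq> {}"
    using that card_root_solutions_translate[OF H m0, where K = "\<real>"] by auto
  have odd: "has_number (first_N_eigenvector_points m n ?L) (real (card (?S 1)) - 1) \<and>
      has_number (first_N_eigenvector_points m n ?Q) 0" if "odd m"
  proof -
    have "?S (-1) = ?R (-1)"
      using root_solutions_minus_1_real[OF H conn that] by auto
    then show ?thesis
      using L Q card_real_root_solutions_1_odd[OF H that] by simp
  qed
  have R1: "real (card (?R 1)) = 2 powi (int n - 1 - int rbar)" if "even m"
    using card_real_root_solutions_1_even[of m n es] H that m0 assms(5,8) by simp
  have even_H: "has_number (first_N_eigenvector_points m n ?Q)
      (real (card (?S 1)) - real (card (?R 1)))" if "H_eigenvalue m n ?Q 0"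
  proof -
    have "?R (-1) \<noteq> {}"
      using that HQ by blast
    moreover from this have "?S (-1) \<noteq> {}"
      by auto
    ultimately show ?thesis
      using Q S_minus_1 R_minus_1 by simp
  qed
  have even_N: "has_number (first_N_eigenvector_points m n ?Q) (real (card (?S 1)))"
    if N: "N_eigenvalue m n ?Q 0"
  proof -
    obtain x where "eigenvector_of m n ?Q 0 x"
      using N by (auto simp: N_eigenvalue_def)
    moreover have "eigenvector_of m n ?Q 0 x \<longleftrightarrow>
        (\<exists>c. c \<noteq> 0 \<and> (\<exists>y\<in>?S (-1). x = c \<cdot>\<^sub>v y))"
      by (rule eigenvector_of_0_iff_root_solution[OF H conn m0])
        (simp_all add: signless_laplacian_tensor_def)
    ultimately have "?S (-1) \<noteq> {}"
      by auto
    \<comment> \<open>For an N-eigenvalue solutions exist but none is real, so the full count is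
      transported and nothing is subtracted.\<close>
    moreover have "\<not> H_eigenvalue m n ?Q 0"
      using N by (auto simp: N_eigenvalue_def N_eigenvector_def H_eigenvalue_def H_eigenvector_def)
    then have "?R (-1) = {}"
      using HQ by blast
    ultimately show ?thesis
      using Q S_minus_1 by (simp only: card.empty) simp
  qed
  show ?thesis
    using odd L R1 even_H even_N by (auto simp flip: S1)
qed

end
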